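(* The longest $(5/2)$-free word over the binary alphabet $\{0,1\}$ whose curling-number transform is $3^+$-free has length $75$. That is, there exists a $(5/2)$-free binary word $x$ of length $75$ with $C(x)$ being $3^+$-free, and there is no such word of length greater than $75$.
   Context: Words are indexed from $0$: a finite word of length $n$ is $x = x[0]x[1]\cdots x[n-1]$, and $x[i..j]$ denotes the factor (contiguous block) $x[i]\cdots x[j]$. A finite word $x$ of length $n \ge 1$ has period $p$, $1\le p\le n$, if $x[i]=x[i+p]$ for all $0\le i<n-p$; its exponent is $n/p$ where $p$ is its least period. A word is $\alpha$-free if it has no nonempty finite factor of exponent at least $\alpha$, and $\alpha^+$-free if it has no nonempty finite factor of exponent strictly greater than $\alpha$. The curling number of a nonempty finite word $u$ is the largest integer $k \ge 1$ such that $u = y z^k$ for some (possibly empty) word $y$ and some nonempty word $z$. For a finite or infinite word $x$, the curling-number transform $C(x)$ is the word over the positive integers, of the same length as $x$, whose $i$-th letter $C(x)[i]$ is the curling number of the prefix $x[0..i]$. *)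

theory Defs
  imports Complex_Main "HOL-Library.Sublist"
begin

text \<open>Finite words are lists and infinite words are functions on \<open>nat\<close>, both indexed from 0;
  the factors of a finite word are its (contiguous) sublists.\<close>

definition has_period :: "'a list \<Rightarrow> nat \<Rightarrow> bool" where
  "has_period x p \<longleftrightarrow> 1 \<le> p \<and> p \<le> length x \<and> (\<forall>i < length x - p. x ! i = x ! (i + p))"

definition least_period :: "'a list \<Rightarrow> nat" where
  "least_period x = (LEAST p. has_period x p)"

text \<open>Meaningful for nonempty words only: the empty word has no period.\<close>

definition exponent :: "'a list \<Rightarrow> real" where
  "exponent x = real (length x) / real (least_period x)"

definition power_free :: "real \<Rightarrow> 'a list \<Rightarrow> bool" where
  "power_free \<alpha> x \<longleftrightarrow> \<not> (\<exists>u. sublist u x \<and> u \<noteq> [] \<and> exponent u \<ge> \<alpha>)"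

definition power_plus_free :: "real \<Rightarrow> 'a list \<Rightarrow> bool" where
  "power_plus_free \<alpha> x \<longleftrightarrow> \<not> (\<exists>u. sublist u x \<and> u \<noteq> [] \<and> exponent u > \<alpha>)"

text \<open>For nonempty \<open>u\<close> the maximum exists: \<open>k = 1\<close> is attained with \<open>y\<close> empty and \<open>z = u\<close>,
  and \<open>z \<noteq> []\<close> forces \<open>k \<le> length u\<close>. The value on the empty word is irrelevant.\<close>

definition curling_number :: "'a list \<Rightarrow> nat" where
  "curling_number u =
    (GREATEST k. k \<ge> 1 \<and> (\<exists>y z. z \<noteq> [] \<and> u = y @ concat (replicate k z)))"

definition curling_transform :: "'a list \<Rightarrow> nat list" where
  "curling_transform x = map (\<lambda>i. curling_number (take (Suc i) x)) [0..<length x]"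

definition inf_factor :: "(nat \<Rightarrow> 'a) \<Rightarrow> nat \<Rightarrow> nat \<Rightarrow> 'a list" where
  "inf_factor w i n = map w [i..<i + n]"

definition inf_power_free :: "real \<Rightarrow> (nat \<Rightarrow> 'a) \<Rightarrow> bool" where
  "inf_power_free \<alpha> w \<longleftrightarrow> \<not> (\<exists>i n. n \<ge> 1 \<and> exponent (inf_factor w i n) \<ge> \<alpha>)"

definition inf_power_plus_free :: "real \<Rightarrow> (nat \<Rightarrow> 'a) \<Rightarrow> bool" where
  "inf_power_plus_free \<alpha> w \<longleftrightarrow> \<not> (\<exists>i n. n \<ge> 1 \<and> exponent (inf_factor w i n) > \<alpha>)"

definition inf_curling_transform :: "(nat \<Rightarrow> 'a) \<Rightarrow> nat \<Rightarrow> nat" where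
  "inf_curling_transform w i = curling_number (inf_factor w 0 (Suc i))"

end

theory Submission
  imports Defs
begin

text \<open>In a \<open>(5/2)\<close>-free word no cube occurs, so the curling number of a prefix is 2 if the prefix
  ends in a square and 1 otherwise. Both conditions on \<open>x\<close> then only say that certain runs are
  absent from \<open>x\<close> and from the Boolean word of its square-ending positions, and these conditions
  are invariant under renaming the letters, so the first letter may be fixed. An exhaustive
  backtracking search (a few thousand nodes) shows that no word of length 76 survives.\<close>

section \<open>Runs\<close>

text \<open>For \<open>p > 0\<close> this says that the factor of length \<open>p + m\<close> at
  \<open>i\<close> has period \<open>p\<close>: squares are the case \<open>m = p\<close>, cubes
  \<open>m = 2 * p\<close>.\<close>

definition run_at :: "(nat \<Rightarrow> 'a) \<Rightarrow> nat \<Rightarrow> nat \<Rightarrow> nat \<Rightarrow> bool" where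
  "run_at w i p m \<longleftrightarrow> (\<forall>j<m. w (i + j) = w (i + j + p))"

definition avoids_runs :: "(nat \<Rightarrow> nat \<Rightarrow> bool) \<Rightarrow> (nat \<Rightarrow> 'a) \<Rightarrow> nat \<Rightarrow> bool" where
  "avoids_runs Q w N \<longleftrightarrow> (\<forall>i p m. 0 < p \<longrightarrow> i + p + m \<le> N \<longrightarrow> Q p m \<longrightarrow> \<not> run_at w i p m)"

text \<open>Here \<open>n\<close> is a prefix length, so position \<open>i\<close> is the last
  letter of a square when \<open>square_ends w (Suc i)\<close> holds.\<close>

definition square_ends :: "(nat \<Rightarrow> 'a) \<Rightarrow> nat \<Rightarrow> bool" where
  "square_ends w n \<longleftrightarrow> (\<exists>i p. 0 < p \<and> i + 2 * p = n \<and> run_at w i p p)"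

text \<open>A run only compares letters with each other, so the equality pattern decides. This
  permits renaming letters, truncating, and replacing the values 1 and 2 by Booleans.\<close>

lemma run_at_cong:
  assumes "\<And>i j. i < N \<Longrightarrow> j < N \<Longrightarrow> v i = v j \<longleftrightarrow> w i = w j" and "i + p + m \<le> N"
  shows "run_at v i p m \<longleftrightarrow> run_at w i p m"
  unfolding run_at_def using assms by (intro all_cong1 imp_cong refl assms(1)) auto

lemma avoids_runs_cong:
  assumes "\<And>i j. i < N \<Longrightarrow> j < N \<Longrightarrow> v i = v j \<longleftrightarrow> w i = w j"
  shows "avoids_runs Q v N \<longleftrightarrow> avoids_runs Q w N"
proof -
  have "run_at v i p m \<longleftrightarrow> run_at w i p m" if "i + p + m \<le> N" for i p m
    using assms that by (rule run_at_cong)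
  then show ?thesis unfolding avoids_runs_def by blast
qed

lemma square_ends_cong:
  assumes "\<And>i j. i < N \<Longrightarrow> j < N \<Longrightarrow> v i = v j \<longleftrightarrow> w i = w j" and "n \<le> N"
  shows "square_ends v n \<longleftrightarrow> square_ends w n"
proof -
  have "run_at v i p p \<longleftrightarrow> run_at w i p p" if "i + 2 * p = n" for i p
    using that assms(2) by (intro run_at_cong[where N = N] assms(1)) auto
  then show ?thesis unfolding square_ends_def by blast
qed

lemma avoids_runs_pred_cong:
  "(\<And>p m. 0 < p \<Longrightarrow> Q p m \<longleftrightarrow> R p m) \<Longrightarrow> avoids_runs Q w N \<longleftrightarrow> avoids_runs R w N"
  unfolding avoids_runs_def by blast

lemma avoids_runs_mono: "avoids_runs Q w N \<Longrightarrow> M \<le> N \<Longrightarrow> avoids_runs Q w M"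
  unfolding avoids_runs_def by (meson le_trans)

section \<open>Exponents of factors expressed by runs\<close>

lemma has_period_least_period:
  assumes "u \<noteq> []" shows "has_period u (least_period u)"
  unfolding least_period_def
  by (rule LeastI[of _ "length u"]) (use assms in \<open>auto simp: has_period_def Suc_le_eq\<close>)

text \<open>A factor with least period \<open>p\<close> is a run of \<open>length u - p\<close>
  matches. Conversely a run supplies some period, perhaps not the least; the exponent is then at
  least \<open>(p + m) / p\<close>, and \<open>mono\<close> transfers \<open>P\<close>. Keeping
  \<open>P\<close> abstract serves both \<ge> and >.\<close>

lemma ex_factor_exponent_iff:
  assumes mono: "\<And>a b :: real. P a \<Longrightarrow> a \<le> b \<Longrightarrow> P b"
  shows "(\<exists>u. sublist u x \<and> u \<noteq> [] \<and> P (exponent u)) \<longleftrightarrow>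
    \<not> avoids_runs (\<lambda>p m. P (real (p + m) / real p)) ((!) x) (length x)"
proof
  assume "\<exists>u. sublist u x \<and> u \<noteq> [] \<and> P (exponent u)"
  then obtain a u b where x: "x = a @ u @ b" and u: "u \<noteq> []" "P (exponent u)"
    by (auto simp: sublist_def)
  define p where "p = least_period u"
  have per: "1 \<le> p" "p \<le> length u" "\<And>i. i < length u - p \<Longrightarrow> u ! i = u ! (i + p)"
    using has_period_least_period[OF u(1)] by (auto simp: has_period_def p_def)
  have "run_at ((!) x) (length a) p (length u - p)"
    unfolding run_at_def
  proof (intro allI impI)
    fix j assume j: "j < length u - p"
    have "j < length u" "j + p < length u" using j by auto
    then have "x ! (length a + j) = u ! j" "x ! (length a + j + p) = u ! (j + p)"
      by (simp_all add: x nth_append add.assoc)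
    then show "x ! (length a + j) = x ! (length a + j + p)" using per(3)[OF j] by simp
  qed
  moreover have "P (real (p + (length u - p)) / real p)"
    using u(2) per(2) by (simp add: exponent_def flip: p_def)
  moreover have "length a + p + (length u - p) \<le> length x"
    using per(2) by (simp add: x)
  ultimately show "\<not> avoids_runs (\<lambda>p m. P (real (p + m) / real p)) ((!) x) (length x)"
    using per(1) unfolding avoids_runs_def
    by (intro notI) (drule spec[of _ "length a"], drule spec[of _ p], drule spec[of _ "length u - p"], simp)
next
  assume "\<not> avoids_runs (\<lambda>p m. P (real (p + m) / real p)) ((!) x) (length x)"
  then obtain i p m where i: "0 < p" "i + p + m \<le> length x" "P (real (p + m) / real p)"
    and run: "run_at ((!) x) i p m"
    unfolding avoids_runs_def by blast
  define u where "u = take (p + m) (drop i x)"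
  have len: "length u = p + m" using i by (simp add: u_def)
  have "has_period u p"
    using run i by (auto simp: has_period_def len u_def run_at_def add.assoc)
  then have "least_period u \<le> p" unfolding least_period_def by (rule Least_le)
  moreover have "u \<noteq> []" using len i(1) by auto
  then have "0 < least_period u" using has_period_least_period[of u] by (simp add: has_period_def)
  ultimately have "real (p + m) / real p \<le> exponent u"
    unfolding exponent_def len by (intro divide_left_mono) (use i(1) in auto)
  moreover have "sublist u x"
    unfolding u_def by (metis append_take_drop_id sublist_def)
  ultimately show "\<exists>u. sublist u x \<and> u \<noteq> [] \<and> P (exponent u)"
    using mono i(3) \<open>u \<noteq> []\<close> by blast
qed

lemma power_free_iff:
  "power_free (5/2) x \<longleftrightarrow> avoids_runs (\<lambda>p m. 3 * p \<le> 2 * m) ((!) x) (length x)"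
proof -
  have *: "0 < p \<Longrightarrow> (5/2 \<le> real (p + m) / real p) \<longleftrightarrow> 3 * p \<le> 2 * m" for p m
    by (simp add: field_simps) linarith
  show ?thesis
    unfolding power_free_def using ex_factor_exponent_iff[of "\<lambda>a. a \<ge> 5/2" x]
      avoids_runs_pred_cong[OF *] by simp
qed

lemma power_plus_free_iff:
  "power_plus_free 3 x \<longleftrightarrow> avoids_runs (\<lambda>p m. 2 * p < m) ((!) x) (length x)"
proof -
  have *: "0 < p \<Longrightarrow> (3 < real (p + m) / real p) \<longleftrightarrow> 2 * p < m" for p m
    by (simp add: field_simps) linarith
  show ?thesis
    unfolding power_plus_free_def using ex_factor_exponent_iff[of "\<lambda>a. a > 3" x]
      avoids_runs_pred_cong[OF *] by simp
qed

section \<open>Curling numbers of words without cubes\<close>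

text \<open>With \<open>c\<close> the \<open>k\<close>-fold power of \<open>z\<close>, the full
  power is both \<open>z @ c\<close> and \<open>c @ z\<close>, which places each letter of
  \<open>c\<close> at two positions \<open>length z\<close> apart.\<close>

lemma run_at_suffix_power:
  assumes "u = y @ concat (replicate (Suc k) z)"
  shows "run_at ((!) u) (length y) (length z) (k * length z)"
proof -
  define c where "c = concat (replicate k z)"
  have len: "length c = k * length z"
    by (simp add: c_def length_concat sum_list_replicate)
  have u1: "u = y @ z @ c" using assms by (simp add: c_def)
  have "concat (replicate (Suc k) z) = c @ z"
    by (simp add: c_def flip: replicate_append_same)
  then have u2: "u = y @ c @ z" using assms by simp
  show ?thesis
    unfolding run_at_def
  proof (intro allI impI)
    fix j assume "j < k * length z"
    then have "u ! (length y + j) = c ! j"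
      by (simp add: u2 nth_append len)
    also have "c ! j = u ! (length y + j + length z)"
      using \<open>j < k * length z\<close> by (simp add: u1 nth_append len)
    finally show "u ! (length y + j) = u ! (length y + j + length z)" .
  qed
qed

lemma square_ends_iff:
  "square_ends ((!) u) (length u) \<longleftrightarrow> (\<exists>y z. z \<noteq> [] \<and> u = y @ z @ z)"
proof
  assume "square_ends ((!) u) (length u)"
  then obtain i p where p: "0 < p" "i + 2 * p = length u" and run: "run_at ((!) u) i p p"
    by (auto simp: square_ends_def)
  define z where "z = take p (drop i u)"
  have "drop (i + p) u = z"
    by (rule nth_equalityI) (use p run in \<open>auto simp: z_def run_at_def ac_simps\<close>)
  then have "u = take i u @ z @ z"
    by (metis append_take_drop_id drop_drop add.commute z_def)
  moreover have "z \<noteq> []" using p by (auto simp: z_def)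
  ultimately show "\<exists>y z. z \<noteq> [] \<and> u = y @ z @ z" by blast
next
  assume "\<exists>y z. z \<noteq> [] \<and> u = y @ z @ z"
  then obtain y z where z: "z \<noteq> []" and u: "u = y @ z @ z" by blast
  then have "run_at ((!) u) (length y) (length z) (1 * length z)"
    using run_at_suffix_power[of u y 1 z] by simp
  then show "square_ends ((!) u) (length u)"
    using z u unfolding square_ends_def
    by (intro exI[of _ "length y"] exI[of _ "length z"]) simp
qed

text \<open>Three or more copies at the end give a run with \<open>m\<close> \<ge>
  \<open>2 * p\<close>, hence \<open>3 * p\<close> \<le> \<open>2 * m\<close>, which is forbidden.
  So only 1 and 2 remain, and 2 means that some suffix is a square.\<close>

lemma curling_number_eq:
  assumes u: "u \<noteq> []"
    and free: "avoids_runs (\<lambda>p m. 3 * p \<le> 2 * m) ((!) u) (length u)"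
  shows "curling_number u = (if square_ends ((!) u) (length u) then 2 else 1)"
proof -
  let ?K = "\<lambda>k. k \<ge> 1 \<and> (\<exists>y z. z \<noteq> [] \<and> u = y @ concat (replicate k z))"
  have K1: "?K 1" using u by (intro conjI exI[of _ "[]"] exI[of _ u]) simp_all
  have K2: "?K 2 \<longleftrightarrow> square_ends ((!) u) (length u)"
    by (simp add: square_ends_iff numeral_2_eq_2)
  have le2: "k \<le> 2" if "?K k" for k
  proof (rule ccontr)
    assume "\<not> k \<le> 2"
    then obtain l where l: "k = Suc l" "2 \<le> l" by (cases k) auto
    from that obtain y z where z: "z \<noteq> []" "u = y @ concat (replicate (Suc l) z)"
      using l by blast
    have "run_at ((!) u) (length y) (length z) (l * length z)"
      using z(2) by (rule run_at_suffix_power)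
    moreover have "length y + length z + l * length z \<le> length u"
      by (simp add: z(2) length_concat sum_list_replicate)
    moreover have "3 * length z \<le> 2 * (l * length z)"
      using mult_le_mono1[OF l(2), of "length z"] by linarith
    ultimately show False using free z(1) unfolding avoids_runs_def by blast
  qed
  have le1: "k \<le> 1" if "?K k" "\<not> ?K 2" for k
    using le2[OF that(1)] that by (metis le_antisym not_less_eq_eq one_add_one plus_1_eq_Suc)
  have "(GREATEST k. ?K k) = (if ?K 2 then 2 else 1)"
  proof (cases "?K 2")
    case True
    have "(GREATEST k. ?K k) = 2" using True le2 by (rule Greatest_equality[of ?K])
    with True show ?thesis by simp
  next
    case False
    have "(GREATEST k. ?K k) = 1" using K1 le1[OF _ False] by (rule Greatest_equality[of ?K])
    with False show ?thesis by simp
  qed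
  then show ?thesis unfolding curling_number_def K2 .
qed

lemma curling_transform_nth:
  assumes "power_free (5/2) x" and "i < length x"
  shows "curling_transform x ! i = (if square_ends ((!) x) (Suc i) then 2 else 1)"
proof -
  let ?u = "take (Suc i) x"
  have len: "length ?u = Suc i" using assms(2) by simp
  have eq: "?u ! a = ?u ! b \<longleftrightarrow> x ! a = x ! b" if "a < Suc i" "b < Suc i" for a b
    using that by simp
  have "avoids_runs (\<lambda>p m. 3 * p \<le> 2 * m) ((!) x) (Suc i)"
    using assms by (auto simp: power_free_iff intro: avoids_runs_mono)
  then have "avoids_runs (\<lambda>p m. 3 * p \<le> 2 * m) ((!) ?u) (length ?u)"
    unfolding len by (subst avoids_runs_cong[OF eq])
  then have "curling_number ?u = (if square_ends ((!) ?u) (Suc i) then 2 else 1)"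
    using curling_number_eq[of ?u] len by fastforce
  also have "square_ends ((!) ?u) (Suc i) \<longleftrightarrow> square_ends ((!) x) (Suc i)"
    by (rule square_ends_cong[OF eq]) auto
  finally show ?thesis using assms(2) by (simp add: curling_transform_def del: upt_Suc)
qed

text \<open>The transform takes only the values 2 and 1, and runs see only equality, so Boolean
  flags may replace it.\<close>

lemma power_plus_free_curling_iff:
  assumes "power_free (5/2) x"
  shows "power_plus_free 3 (curling_transform x) \<longleftrightarrow>
    avoids_runs (\<lambda>p m. 2 * p < m) (\<lambda>i. square_ends ((!) x) (Suc i)) (length x)"
proof -
  have "length (curling_transform x) = length x" by (simp add: curling_transform_def)
  then show ?thesis
    unfolding power_plus_free_iff
    by (auto intro!: avoids_runs_cong simp: curling_transform_nth[OF assms] split: if_splits)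
qed

section \<open>Exhaustive search\<close>

text \<open>Words are built by appending letters, so the search keeps them reversed. Evaluation is by
  rewriting: only \<open>if\<close> protects its branches from being evaluated, hence no Boolean connectives,
  and \<open>agree\<close> counts in unary.\<close>

fun agree :: "nat \<Rightarrow> 'a list \<Rightarrow> 'a list \<Rightarrow> bool" where
  "agree 0 r s = True"
| "agree (Suc m) (a # r) (b # s) = (if a = b then agree m r s else False)"
| "agree (Suc m) _ _ = False"

text \<open>On reversed words a square suffix becomes a prefix. The third argument is meant to be
  \<open>r\<close> without its first \<open>p\<close> letters, so shift and block length grow
  together.\<close>

fun square_prefix_from :: "nat \<Rightarrow> 'a list \<Rightarrow> 'a list \<Rightarrow> bool" where
  "square_prefix_from p r [] = False"
| "square_prefix_from p r (a # s) =
     (if agree p r (a # s) then True else square_prefix_from (Suc p) r s)"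

fun run_prefix :: "(nat \<times> nat) list \<Rightarrow> 'a list \<Rightarrow> bool" where
  "run_prefix [] r = False"
| "run_prefix ((p, m) # ps) r = (if agree m r (drop p r) then True else run_prefix ps r)"

text \<open>\<open>ps\<close> lists forbidden runs of the word, \<open>qs\<close> those of its flags
  \<open>c\<close>. Each test sees only runs ending at the newest letter; earlier ends belong to
  ancestors in the search tree. The nested \<open>if\<close> is the conjunction over the two
  possible next letters.\<close>

fun no_extension ::
  "(nat \<times> nat) list \<Rightarrow> (nat \<times> nat) list \<Rightarrow> nat \<Rightarrow> bool list \<Rightarrow> bool list \<Rightarrow> bool" where
  "no_extension ps qs 0 r c = run_prefix qs c"
| "no_extension ps qs (Suc k) r c =
     (if run_prefix qs c then True
      else if (if run_prefix ps (True # r) then True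
               else no_extension ps qs k (True # r) (square_prefix_from 1 (True # r) r # c))
      then (if run_prefix ps (False # r) then True
            else no_extension ps qs k (False # r) (square_prefix_from 1 (False # r) r # c))
      else False)"

section \<open>Soundness of the search\<close>

definition rev_prefix :: "(nat \<Rightarrow> 'a) \<Rightarrow> nat \<Rightarrow> 'a list" where
  "rev_prefix w n = rev (map w [0..<n])"

lemma rev_prefix_Suc [simp]: "rev_prefix w (Suc n) = w n # rev_prefix w n"
  by (simp add: rev_prefix_def)

lemma length_rev_prefix [simp]: "length (rev_prefix w n) = n"
  by (simp add: rev_prefix_def)

lemma nth_rev_prefix: "j < n \<Longrightarrow> rev_prefix w n ! j = w (n - Suc j)"
  by (simp add: rev_prefix_def rev_nth)

lemma agree_iff:
  "agree m r s \<longleftrightarrow> m \<le> length r \<and> m \<le> length s \<and> (\<forall>j<m. r ! j = s ! j)"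
  by (induction m r s rule: agree.induct) (auto simp: All_less_Suc2)

text \<open>Reversal puts the last letters first, so agreement at shift \<open>p\<close> is a run
  ending exactly at \<open>n\<close>. With \<open>m > 0\<close> the comparison fails on too short a
  word; for \<open>m = 0\<close> it would succeed vacuously.\<close>

lemma agree_rev_prefix:
  assumes "0 < m"
  shows "agree m (rev_prefix w n) (drop p (rev_prefix w n)) \<longleftrightarrow>
    p + m \<le> n \<and> run_at w (n - (p + m)) p m"
proof (cases "p + m \<le> n")
  case True
  have "(\<forall>j<m. w (n - Suc j) = w (n - Suc (p + j))) \<longleftrightarrow> run_at w (n - (p + m)) p m"
    unfolding run_at_def
  proof (intro iffI allI impI)
    fix j assume *: "\<forall>j<m. w (n - Suc j) = w (n - Suc (p + j))" "j < m"
    \<comment> \<open>The reflection of \<open>j\<close> to \<open>m - Suc j\<close> turns reversed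
      indices into forward ones.\<close>
    have "n - Suc (m - Suc j) = n - (p + m) + j + p" "n - Suc (p + (m - Suc j)) = n - (p + m) + j"
      using True \<open>j < m\<close> by auto
    moreover have "m - Suc j < m" using \<open>j < m\<close> by simp
    ultimately show "w (n - (p + m) + j) = w (n - (p + m) + j + p)" using *(1) by metis
  next
    fix j assume *: "\<forall>j<m. w (n - (p + m) + j) = w (n - (p + m) + j + p)" "j < m"
    have "n - Suc j = n - (p + m) + (m - Suc j) + p" "n - Suc (p + j) = n - (p + m) + (m - Suc j)"
      using True \<open>j < m\<close> by auto
    moreover have "m - Suc j < m" using \<open>j < m\<close> by simp
    ultimately show "w (n - Suc j) = w (n - Suc (p + j))" using *(1) by metis
  qed
  then show ?thesis using True by (auto simp: agree_iff nth_rev_prefix)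
next
  case False
  then show ?thesis using assms by (auto simp: agree_iff)
qed

lemma run_prefix_iff: "run_prefix ps r \<longleftrightarrow> (\<exists>(p, m) \<in> set ps. agree m r (drop p r))"
  by (induction ps r rule: run_prefix.induct) auto

text \<open>A hit exhibits a forbidden run ending at \<open>n\<close>. As the converse is not
  claimed, \<open>ps\<close> may be any finite selection of forbidden pairs.\<close>

lemma run_prefix_not_avoids_runs:
  assumes "run_prefix ps (rev_prefix w n)" and "\<forall>(p, m) \<in> set ps. 0 < p \<and> 0 < m \<and> Q p m"
  shows "\<not> avoids_runs Q w n"
proof -
  from assms obtain p m where pm: "0 < p" "0 < m" "Q p m"
    and "agree m (rev_prefix w n) (drop p (rev_prefix w n))"
    unfolding run_prefix_iff by blast
  then have "p + m \<le> n" "run_at w (n - (p + m)) p m" by (simp_all add: agree_rev_prefix)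
  moreover from this have "n - (p + m) + p + m \<le> n" by simp
  ultimately show ?thesis using pm unfolding avoids_runs_def by blast
qed

lemma square_prefix_from_iff:
  "square_prefix_from p r s \<longleftrightarrow> (\<exists>q < length s. agree (p + q) r (drop q s))"
  by (induction p r s rule: square_prefix_from.induct) (auto simp: Ex_less_Suc2)

lemma square_prefix_rev_prefix:
  "square_prefix_from 1 (rev_prefix w (Suc n)) (rev_prefix w n) \<longleftrightarrow> square_ends w (Suc n)"
proof -
  have "square_prefix_from 1 (rev_prefix w (Suc n)) (rev_prefix w n) \<longleftrightarrow>
      (\<exists>q<n. agree (Suc q) (rev_prefix w (Suc n)) (drop (Suc q) (rev_prefix w (Suc n))))"
    by (simp add: square_prefix_from_iff)
  also have "\<dots> \<longleftrightarrow> (\<exists>q<n. Suc q + Suc q \<le> Suc n \<and>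
      run_at w (Suc n - (Suc q + Suc q)) (Suc q) (Suc q))"
    by (subst agree_rev_prefix) simp_all
  also have "\<dots> \<longleftrightarrow> square_ends w (Suc n)"
  proof
    assume "\<exists>q<n. Suc q + Suc q \<le> Suc n \<and> run_at w (Suc n - (Suc q + Suc q)) (Suc q) (Suc q)"
    then obtain q where "Suc q + Suc q \<le> Suc n"
      "run_at w (Suc n - (Suc q + Suc q)) (Suc q) (Suc q)" by blast
    then show "square_ends w (Suc n)" unfolding square_ends_def
      by (intro exI[of _ "Suc n - (Suc q + Suc q)"] exI[of _ "Suc q"]) auto
  next
    assume "square_ends w (Suc n)"
    then obtain i p where p: "0 < p" "i + 2 * p = Suc n" "run_at w i p p"
      by (auto simp: square_ends_def)
    then obtain q where q: "p = Suc q" by (cases p) auto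
    have i: "i = Suc n - (Suc q + Suc q)" using p q by simp
    show "\<exists>q<n. Suc q + Suc q \<le> Suc n \<and> run_at w (Suc n - (Suc q + Suc q)) (Suc q) (Suc q)"
      by (rule exI[of _ q]) (use p q in \<open>auto simp flip: i\<close>)
  qed
  finally show ?thesis .
qed

text \<open>Induction on \<open>k\<close> follows the branch spelled by \<open>w\<close>. A hit
  there is a forbidden run in a prefix, which persists in longer prefixes; otherwise
  \<open>w n\<close> selects the subtree for the induction hypothesis.\<close>

lemma no_extension_sound:
  fixes w :: "nat \<Rightarrow> bool"
  defines "c \<equiv> \<lambda>i. square_ends w (Suc i)"
  assumes "no_extension ps qs k (rev_prefix w n) (rev_prefix c n)"
    and ps: "\<forall>(p, m) \<in> set ps. 0 < p \<and> 0 < m \<and> Q p m"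
    and qs: "\<forall>(p, m) \<in> set qs. 0 < p \<and> 0 < m \<and> R p m"
  shows "\<not> (avoids_runs Q w (n + k) \<and> avoids_runs R c (n + k))"
  using assms(2)
proof (induction k arbitrary: n)
  case 0
  then show ?case using run_prefix_not_avoids_runs[OF _ qs] by auto
next
  case (Suc k)
  show ?case
  proof (cases "run_prefix qs (rev_prefix c n) \<or> run_prefix ps (rev_prefix w (Suc n))")
    case True
    then have "\<not> avoids_runs R c n \<or> \<not> avoids_runs Q w (Suc n)"
      using run_prefix_not_avoids_runs[OF _ qs] run_prefix_not_avoids_runs[OF _ ps] by blast
    then show ?thesis
      using avoids_runs_mono[of R c "n + Suc k" n] avoids_runs_mono[of Q w "n + Suc k" "Suc n"]
      by auto
  next
    case False
    have "rev_prefix c (Suc n) =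
        square_prefix_from 1 (w n # rev_prefix w n) (rev_prefix w n) # rev_prefix c n"
      using square_prefix_rev_prefix[of w n] by (simp add: c_def)
    then have "no_extension ps qs k (rev_prefix w (Suc n)) (rev_prefix c (Suc n))"
      using Suc.prems False by (cases "w n") (auto split: if_splits)
    from Suc.IH[OF this] show ?thesis by simp
  qed
qed

text \<open>The periods listed here, each with its shortest forbidden run, already close the search.\<close>

lemma no_extension_76:
  "no_extension [(1, 2), (2, 3), (3, 5), (4, 6), (6, 9)]
     [(1, 3), (3, 7), (5, 11), (20, 41), (4, 9), (2, 5)] 75 [True] [False]"
  by code_simp

lemma no_binary_word_76:
  fixes w :: "nat \<Rightarrow> nat"
  assumes bin: "\<And>i. i < 76 \<Longrightarrow> w i \<in> {0, 1}"
    and Q: "avoids_runs (\<lambda>p m. 3 * p \<le> 2 * m) w 76"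
    and R: "avoids_runs (\<lambda>p m. 2 * p < m) (\<lambda>i. square_ends w (Suc i)) 76"
  shows False
proof -
  \<comment> \<open>Over two letters, comparison with the first letter is an injective renaming that
    makes the first letter \<open>True\<close>.\<close>
  define v where "v i \<longleftrightarrow> w i = w 0" for i
  have eq: "w i = w j \<longleftrightarrow> v i = v j" if "i < 76" "j < 76" for i j
    using bin[of i] bin[of j] bin[of 0] that by (auto simp: v_def)
  have "avoids_runs (\<lambda>p m. 3 * p \<le> 2 * m) v 76"
    using Q by (subst avoids_runs_cong[OF eq, symmetric])
  moreover have "square_ends w (Suc i) \<longleftrightarrow> square_ends v (Suc i)" if "i < 76" for i
    using that by (intro square_ends_cong[OF eq]) auto
  then have "avoids_runs (\<lambda>p m. 2 * p < m) (\<lambda>i. square_ends v (Suc i)) 76"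
    using R by (subst avoids_runs_cong[where w = "\<lambda>i. square_ends w (Suc i)"]) auto
  \<comment> \<open>A single letter contains no square, so the search starts from the flag
    \<open>False\<close> with 75 letters still to add.\<close>
  moreover have "\<not> square_ends v (Suc 0)" by (auto simp: square_ends_def)
  then have "rev_prefix v 1 = [True]" "rev_prefix (\<lambda>i. square_ends v (Suc i)) 1 = [False]"
    by (simp_all add: rev_prefix_def v_def)
  then have "\<not> (avoids_runs (\<lambda>p m. 3 * p \<le> 2 * m) v (1 + 75) \<and>
      avoids_runs (\<lambda>p m. 2 * p < m) (\<lambda>i. square_ends v (Suc i)) (1 + 75))"
    by (intro no_extension_sound[OF no_extension_76[folded \<open>rev_prefix v 1 = _\<close>
          \<open>rev_prefix (\<lambda>i. square_ends v (Suc i)) 1 = _\<close>]]) auto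
  ultimately show False by simp
qed

section \<open>The word of length 75\<close>

text \<open>Words stay in forward order here: a run at \<open>i\<close> shows at the front of
  \<open>drop i x\<close>. Testing length \<open>f p\<close> suffices because longer runs contain
  it, and \<open>0 < f p\<close> confines \<open>p\<close> below \<open>length x\<close>.\<close>

lemma avoids_runsI:
  assumes "\<forall>r \<in> set (suffixes x). \<not> run_prefix (map (\<lambda>p. (p, f p)) [1..<length x]) r"
    and "\<And>p m. 0 < p \<Longrightarrow> Q p m \<Longrightarrow> 0 < f p \<and> f p \<le> m"
  shows "avoids_runs Q ((!) x) (length x)"
  unfolding avoids_runs_def
proof (intro allI impI notI)
  fix i p m
  assume p: "0 < p" "i + p + m \<le> length x" "Q p m" and run: "run_at ((!) x) i p m"
  have f: "0 < f p" "f p \<le> m" using assms(2) p by auto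
  have "agree (f p) (drop i x) (drop p (drop i x))"
    using p f run by (auto simp: agree_iff run_at_def ac_simps)
  moreover have "p \<in> set [1..<length x]" using p f by simp
  moreover have "drop i x \<in> set (suffixes x)" by (simp add: suffix_drop)
  ultimately show False using assms(1) by (auto simp: run_prefix_iff simp del: drop_drop)
qed

definition word75 :: "nat list" where
  "word75 = [0,1,1,0,0,1,1,0,1,1,0,0,1,0,0,1,1,0,1,0,0,1,0,1,1,0,0,1,0,0,1,1,0,1,1,0,0,1,
     0,1,1,0,1,0,0,1,1,0,1,1,0,0,1,0,0,1,1,0,1,0,0,1,0,1,1,0,0,1,1,0,1,0,0,1,1]"

text \<open>A form of \<open>square_ends\<close> that can be evaluated; reversing the prefixes lets
  the square test of the search be reused.\<close>

definition square_flags :: "'a list \<Rightarrow> bool list" where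
  "square_flags x =
     map (\<lambda>n. square_prefix_from 1 (rev (take (Suc n) x)) (rev (take n x))) [0..<length x]"

lemma rev_prefix_nth: "n \<le> length x \<Longrightarrow> rev_prefix ((!) x) n = rev (take n x)"
  by (simp add: rev_prefix_def list_eq_iff_nth_eq rev_nth)

lemma square_flags_nth:
  "i < length x \<Longrightarrow> square_flags x ! i \<longleftrightarrow> square_ends ((!) x) (Suc i)"
  using square_prefix_rev_prefix[of "(!) x" i]
  by (simp add: square_flags_def rev_prefix_nth del: rev_prefix_Suc)

text \<open>The bound is the ceiling of \<open>3 * p / 2\<close>, the least \<open>m\<close> with
  \<open>3 * p\<close> \<le> \<open>2 * m\<close>.\<close>

lemma word75_runs:
  "\<forall>r \<in> set (suffixes word75).
     \<not> run_prefix (map (\<lambda>p. (p, (3 * p + 1) div 2)) [1..<length word75]) r"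
  by code_simp

lemma word75_square_flags_runs:
  "\<forall>r \<in> set (suffixes (square_flags word75)).
     \<not> run_prefix (map (\<lambda>p. (p, 2 * p + 1)) [1..<length (square_flags word75)]) r"
  by code_simp

lemma power_free_word75: "power_free (5/2) word75"
  unfolding power_free_iff by (rule avoids_runsI[OF word75_runs]) auto

lemma power_plus_free_word75: "power_plus_free 3 (curling_transform word75)"
proof -
  have "avoids_runs (\<lambda>p m. 2 * p < m) ((!) (square_flags word75)) (length (square_flags word75))"
    by (rule avoids_runsI[OF word75_square_flags_runs]) auto
  then have "avoids_runs (\<lambda>p m. 2 * p < m) ((!) (square_flags word75)) (length word75)"
    by (simp add: square_flags_def)
  then show ?thesis
    unfolding power_plus_free_curling_iff[OF power_free_word75]
    by (subst avoids_runs_cong[where w = "(!) (square_flags word75)"])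
      (auto simp: square_flags_nth)
qed

section \<open>Infinite words\<close>

text \<open>A factor of a prefix is a factor of the infinite word, so freeness passes to
  prefixes.\<close>

lemma sublist_map_upt:
  assumes "sublist u (map w [0..<n])"
  shows "\<exists>i. u = inf_factor w i (length u)"
proof -
  obtain a b where ab: "map w [0..<n] = a @ u @ b" using assms by (auto simp: sublist_def)
  have len: "n = length a + length u + length b" using arg_cong[OF ab, of length] by simp
  have "u ! j = w (length a + j)" if "j < length u" for j
    using arg_cong[OF ab, of "\<lambda>l. l ! (length a + j)"] that len by (simp add: nth_append)
  then have "u = inf_factor w (length a) (length u)"
    by (auto simp: inf_factor_def intro!: nth_equalityI)
  then show ?thesis ..
qed

lemma power_free_map_upt: "inf_power_free \<alpha> w \<Longrightarrow> power_free \<alpha> (map w [0..<n])"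
  unfolding inf_power_free_def power_free_def
  using sublist_map_upt by (metis length_0_conv less_one linorder_not_less)

lemma power_plus_free_map_upt: "inf_power_plus_free \<alpha> w \<Longrightarrow> power_plus_free \<alpha> (map w [0..<n])"
  unfolding inf_power_plus_free_def power_plus_free_def
  using sublist_map_upt by (metis length_0_conv less_one linorder_not_less)

text \<open>The curling number at \<open>i\<close> depends only on the prefix of length
  \<open>Suc i\<close>, so the transform commutes with truncation.\<close>

lemma curling_transform_map_upt:
  "curling_transform (map w [0..<n]) = map (inf_curling_transform w) [0..<n]"
  by (auto simp: curling_transform_def inf_curling_transform_def inf_factor_def take_map
      simp del: upt_Suc)

text \<open>Absence of runs restricts to the first 76 positions, so excluding length 76 excludes
  every greater length.\<close>

lemma no_longer_word:
  fixes x :: "nat list"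
  assumes "set x \<subseteq> {0, 1}" "length x > 75"
    and free: "power_free (5/2) x" and "power_plus_free 3 (curling_transform x)"
  shows False
proof (rule no_binary_word_76[of "(!) x"])
  show "x ! i \<in> {0, 1}" if "i < 76" for i
    using that assms(2) by (intro subsetD[OF assms(1)] nth_mem) simp
  show "avoids_runs (\<lambda>p m. 3 * p \<le> 2 * m) ((!) x) 76"
    using free assms(2) by (auto simp: power_free_iff intro: avoids_runs_mono)
  show "avoids_runs (\<lambda>p m. 2 * p < m) (\<lambda>i. square_ends ((!) x) (Suc i)) 76"
    using assms(2,4) by (auto simp: power_plus_free_curling_iff[OF free] intro: avoids_runs_mono)
qed

theorem theorem6:
  shows "(\<exists>x :: nat list. set x \<subseteq> {0, 1} \<and> length x = 75 \<and>
            power_free (5/2) x \<and> power_plus_free 3 (curling_transform x)) \<and>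
         \<not> (\<exists>x :: nat list. set x \<subseteq> {0, 1} \<and> length x > 75 \<and>
            power_free (5/2) x \<and> power_plus_free 3 (curling_transform x)) \<and>
         \<not> (\<exists>w :: nat \<Rightarrow> nat. range w \<subseteq> {0, 1} \<and>
            inf_power_free (5/2) w \<and> inf_power_plus_free 3 (inf_curling_transform w))"
proof (intro conjI notI)
  show "\<exists>x :: nat list. set x \<subseteq> {0, 1} \<and> length x = 75 \<and>
      power_free (5/2) x \<and> power_plus_free 3 (curling_transform x)"
    using power_free_word75 power_plus_free_word75
    by (intro exI[of _ word75]) (simp add: word75_def)
next
  assume "\<exists>x :: nat list. set x \<subseteq> {0, 1} \<and> length x > 75 \<and>
      power_free (5/2) x \<and> power_plus_free 3 (curling_transform x)"
  then show False using no_longer_word by blast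
next
  assume "\<exists>w :: nat \<Rightarrow> nat. range w \<subseteq> {0, 1} \<and>
      inf_power_free (5/2) w \<and> inf_power_plus_free 3 (inf_curling_transform w)"
  then obtain w :: "nat \<Rightarrow> nat" where w: "range w \<subseteq> {0, 1}" "inf_power_free (5/2) w"
    "inf_power_plus_free 3 (inf_curling_transform w)" by blast
  show False
  proof (rule no_longer_word[of "map w [0..<76]"])
    show "set (map w [0..<76]) \<subseteq> {0, 1}" using w(1) by (simp add: image_subset_iff)
    show "power_free (5/2) (map w [0..<76])" using w(2) by (rule power_free_map_upt)
    show "power_plus_free 3 (curling_transform (map w [0..<76]))"
      unfolding curling_transform_map_upt using w(3) by (rule power_plus_free_map_upt)
  qed simp
qed

end
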